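(* For integers $1\le k\le n$ and $[\rho],[\sigma]\in\mathcal{B}(n,k)$, one has $[\rho]=[\sigma]$ if and only if $W_\rho=W_\sigma$.
   Context: Let $\binom{[n]}{k}$ be the set of $k$-element subsets of $[n]=\{1,\dots,n\}$, each written in increasing order, with the conventions $\binom{[n]}{0}=\{\varnothing\}$ and $\binom{[n]}{k}=\varnothing$ for $k>n$. For $X=[x_1<\dots<x_m]$ let $X_i=X\setminus\{x_i\}$; the packet of $X$ is $P(X)=\{X_1,\dots,X_m\}$. The lex order is the lexicographic order of increasing sequences and antilex is its reverse. A total order $\rho=(\rho_1,\dots,\rho_{\binom nk})$ on $\binom{[n]}{k}$ is admissible if for every $X\in\binom{[n]}{k+1}$ the restriction $\rho|_{P(X)}$ is the lex or the antilex order on $P(X)$; the set of admissible orders is $\mathcal{A}(n,k)$. $X,Y\in\binom{[n]}{k}$ commute if $P(X)\cap P(Y)=\varnothing$. Two admissible orders are commutation equivalent if one is obtained from the other by a sequence of transpositions of adjacent commuting elements; $[\rho]$ is the commutation class of $\rho$, and $\mathcal{B}(n,k)$ is the set of commutation classes of elements of $\mathcal{A}(n,k)$ (the underlying set of the higher Bruhat order). Let $\{0,1\}^*$ be the set of finite words over $\{0,1\}$, with empty word $\varnothing$. For $Y\in\binom{[n]}{k}$ define $w_Y:\binom{[n]}{k-1}\to\{0,1\}^*$ by $w_Y(X)=0$ if $X=Y_k$, $w_Y(X)=1$ if $X=Y_1$, and $w_Y(X)=\varnothing$ otherwise. The weaving function of $\rho\in\mathcal{A}(n,k)$ is $W_\rho:\binom{[n]}{k-1}\to\{0,1\}^*$,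 $W_\rho(X)=w_{\rho_1}(X)w_{\rho_2}(X)\cdots w_{\rho_{\binom nk}}(X)$ (concatenation).
   Formalization: The case k = 1 < n is excluded, since the claim fails there: all n! orders of the singletons are admissible and form distinct commutation classes, while W_ρ(∅) is the same word for every ρ; all 2 ≤ k ≤ n and k = n = 1 are covered. *)

theory Defs
  imports "HOL-Library.Ramsey" "HOL-Library.FuncSet" "HOL-Library.Z2"
begin

text \<open>
  The \<open>k\<close>-element subsets of \<open>[n]\<close> are \<open>nsets {1..n} k\<close>.  A total order on them
  is the list of its elements in increasing order.
\<close>

text \<open>\<open>omit X i\<close> is \<open>X\<^sub>i\<close>, with \<open>i\<close> counted from 1.\<close>

definition omit :: "nat set \<Rightarrow> nat \<Rightarrow> nat set" where
  "omit X i = X - {sorted_list_of_set X ! (i - 1)}"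

definition packet :: "nat set \<Rightarrow> nat set set" where
  "packet X = omit X ` {1..card X}"

definition lex_less :: "nat set \<Rightarrow> nat set \<Rightarrow> bool" where
  "lex_less A B \<longleftrightarrow> (sorted_list_of_set A, sorted_list_of_set B) \<in> lexord {(a, b). a < b}"

definition antilex_less :: "nat set \<Rightarrow> nat set \<Rightarrow> bool" where
  "antilex_less A B \<longleftrightarrow> lex_less B A"

definition admissible_orders :: "nat \<Rightarrow> nat \<Rightarrow> nat set list set" where
  "admissible_orders n k =
    {\<rho>. distinct \<rho> \<and> set \<rho> = nsets {1..n} k \<and>
         (\<forall>X \<in> nsets {1..n} (k + 1).
            sorted_wrt lex_less (filter (\<lambda>Y. Y \<in> packet X) \<rho>) \<or>
            sorted_wrt antilex_less (filter (\<lambda>Y. Y \<in> packet X) \<rho>))}"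

definition commute :: "nat set \<Rightarrow> nat set \<Rightarrow> bool" where
  "commute X Y \<longleftrightarrow> packet X \<inter> packet Y = {}"

definition commutation_step :: "(nat set list \<times> nat set list) set" where
  "commutation_step =
    {(xs @ X # Y # ys, xs @ Y # X # ys) | xs X Y ys. commute X Y}"

definition commutation_equiv :: "nat \<Rightarrow> nat \<Rightarrow> (nat set list \<times> nat set list) set" where
  "commutation_equiv n k =
    {(\<rho>, \<sigma>). \<rho> \<in> admissible_orders n k \<and> \<sigma> \<in> admissible_orders n k \<and>
             (\<rho>, \<sigma>) \<in> commutation_step\<^sup>*}"

text \<open>
  The class of a list that is not an admissible order is empty, hence not a member
  of \<open>higher_bruhat n k\<close>.
\<close>

definition commutation_class :: "nat \<Rightarrow> nat \<Rightarrow> nat set list \<Rightarrow> nat set list set" where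
  "commutation_class n k \<rho> = commutation_equiv n k `` {\<rho>}"

definition higher_bruhat :: "nat \<Rightarrow> nat \<Rightarrow> nat set list set set" where
  "higher_bruhat n k = admissible_orders n k // commutation_equiv n k"

text \<open>
  For \<open>k = 1\<close> the two clauses of \<open>letter\<close> overlap (\<open>Y\<^sub>k = Y\<^sub>1 = {}\<close>); the first one is
  given priority.
\<close>

definition letter :: "nat \<Rightarrow> nat set \<Rightarrow> nat set \<Rightarrow> bit list" where
  "letter k Y X = (if X = omit Y k then [0] else if X = omit Y 1 then [1] else [])"

text \<open>
  \<open>restrict\<close> makes equality of weaving functions mean agreement on their domain.
\<close>

definition weaving :: "nat \<Rightarrow> nat \<Rightarrow> nat set list \<Rightarrow> (nat set \<Rightarrow> bit list)" where
  "weaving n k \<rho> =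
    restrict (\<lambda>X. concat (map (\<lambda>Y. letter k Y X) \<rho>)) (nsets {1..n} (k - 1))"

text \<open>
  For \<open>k = 1 < n\<close> weaving functions do not separate commutation classes: every ordering
  of the singletons is admissible and no two singletons commute, so each class has one element,
  while the weaving function does not depend on the ordering.
\<close>

lemma weaving_not_injective_for_singletons:
  assumes "2 \<le> n"
  obtains \<rho> \<sigma> where "commutation_class n 1 \<rho> \<in> higher_bruhat n 1"
    "commutation_class n 1 \<sigma> \<in> higher_bruhat n 1"
    "commutation_class n 1 \<rho> \<noteq> commutation_class n 1 \<sigma>"
    "weaving n 1 \<rho> = weaving n 1 \<sigma>"
proof -
  have packet1: "packet {a} = {{}}" for a
    by (simp add: packet_def omit_def)
  define \<rho> where "\<rho> = map (\<lambda>a. {a}) [1..<Suc n]"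
  have set: "set \<rho> = nsets {1..n} 1"
    by (auto simp: \<rho>_def nsets_def card_1_singleton_iff simp del: upt_Suc)
  have dist: "distinct \<rho>"
    by (auto simp: \<rho>_def distinct_map inj_on_def simp del: upt_Suc)
  have lex: "sorted_wrt lex_less \<rho>"
    by (auto simp: \<rho>_def sorted_wrt_map lex_less_def simp del: upt_Suc)
  have adm: "\<rho> \<in> admissible_orders n 1"
    using set dist lex by (auto simp: admissible_orders_def sorted_wrt_filter)
  have "sorted_wrt antilex_less (rev \<rho>)"
    using lex by (simp add: sorted_wrt_rev antilex_less_def)
  then have adm': "rev \<rho> \<in> admissible_orders n 1"
    using set dist by (auto simp: admissible_orders_def sorted_wrt_filter)
  have no_step: "(\<rho>, \<tau>) \<notin> commutation_step" for \<tau>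
  proof
    assume "(\<rho>, \<tau>) \<in> commutation_step"
    then obtain xs X Y ys where *: "\<rho> = xs @ X # Y # ys" "commute X Y"
      by (auto simp: commutation_step_def)
    then have "X \<in> set \<rho>" "Y \<in> set \<rho>" by auto
    then obtain a b where "X = {a}" "Y = {b}"
      by (auto simp: \<rho>_def simp del: upt_Suc)
    with * show False by (simp add: commute_def packet1)
  qed
  have "\<rho> ! 0 \<noteq> rev \<rho> ! 0"
    using assms by (simp add: \<rho>_def rev_nth nth_append del: upt_Suc)
  then have neq: "rev \<rho> \<noteq> \<rho>" by metis
  have "(\<rho>, rev \<rho>) \<notin> commutation_step\<^sup>*"
    using neq no_step by (auto elim: converse_rtranclE)
  then have "rev \<rho> \<notin> commutation_class n 1 \<rho>"
    by (simp add: commutation_class_def commutation_equiv_def)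
  moreover have "rev \<rho> \<in> commutation_class n 1 (rev \<rho>)"
    using adm' by (simp add: commutation_class_def commutation_equiv_def)
  ultimately have 1: "commutation_class n 1 \<rho> \<noteq> commutation_class n 1 (rev \<rho>)"
    by auto
  have "concat (map (\<lambda>Y. letter 1 Y {}) zs) = replicate (length zs) 0"
    if "\<And>Z. Z \<in> set zs \<Longrightarrow> \<exists>a. Z = {a}" for zs
    using that by (induction zs) (force simp: letter_def omit_def)+
  moreover have "\<exists>a. Z = {a}" if "Z \<in> set \<rho>" for Z
    using that by (auto simp: \<rho>_def simp del: upt_Suc)
  ultimately have "concat (map (\<lambda>Y. letter 1 Y {}) \<rho>) =
      concat (map (\<lambda>Y. letter 1 Y {}) (rev \<rho>))"
    by (metis length_rev set_rev)
  moreover have "nsets {1..n} (1 - 1) = {{}}"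
    by (auto simp: nsets_def)
  ultimately have "weaving n 1 \<rho> = weaving n 1 (rev \<rho>)"
    by (simp add: weaving_def restrict_def fun_eq_iff)
  with 1 adm adm' show thesis
    by (intro that[of \<rho> "rev \<rho>"])
       (auto simp: higher_bruhat_def commutation_class_def quotient_def)
qed

end

theory Submission
  imports Defs
begin

text \<open>
  Two admissible orders \<open>\<rho>\<close> and \<open>\<sigma>\<close> with the same weaving function are compared from the left.
  After a common prefix, let \<open>Y\<close> be the next element of \<open>\<sigma>\<close>, and suppose that some element that
  does not commute with \<open>Y\<close> precedes \<open>Y\<close> in \<open>\<rho>\<close> after that prefix; let \<open>U\<close> be the first one.
  Then \<open>\<rho>\<close> and \<open>\<sigma>\<close> order the packet of \<open>Z = U \<union> Y\<close> oppositely, and \<open>Y\<close> and \<open>U\<close> are the two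
  extreme elements \<open>Z\<^sub>1\<close> and \<open>Z\<^sub>k\<^sub>+\<^sub>1\<close> of that packet. They share the set \<open>Z - {min Z, max Z}\<close>, for
  which \<open>Y\<close> and \<open>U\<close> contribute different letters, and each of these is the first letter after the
  prefix: a contradiction. Hence \<open>Y\<close> can be moved to the front in \<open>\<rho>\<close> by commutations.
\<close>

section \<open>Lists sorted by an asymmetric relation, and the lex order\<close>

lemma sorted_wrt_asymp_unique:
  assumes "asymp R" "sorted_wrt R xs" "sorted_wrt R ys" "set xs = set ys"
  shows "xs = ys"
  using assms(2-4)
proof (induction xs arbitrary: ys)
  case Nil
  then show ?case by simp
next
  case (Cons x xs)
  then obtain y ys' where ys: "ys = y # ys'"
    by (cases ys) auto
  have nin: "x \<notin> set xs" "y \<notin> set ys'"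
    using Cons.prems ys assms(1) by (auto dest: asympD)
  have xy: "x = y"
  proof (rule ccontr)
    assume "x \<noteq> y"
    then have "x \<in> set ys'" "y \<in> set xs"
      using Cons.prems(3) ys by auto
    then show False
      using Cons.prems(1,2) ys assms(1) by (auto dest: asympD)
  qed
  then have "set xs = set ys'"
    using Cons.prems(3) nin ys by auto
  then show ?case
    using Cons ys xy by auto
qed

lemma asymp_lex_less: "asymp lex_less"
proof -
  have "asym (lexord {(a, b). a < (b::nat)})"
    by (intro lexord_asym) (auto intro: asymI)
  then show ?thesis
    by (auto simp: lex_less_def intro!: asympI dest: asymD)
qed

section \<open>Packets\<close>

lemma packet_eq:
  assumes "finite X"
  shows "packet X = (\<lambda>x. X - {x}) ` X"
proof -
  have "packet X = (\<lambda>x. X - {x}) ` ((\<lambda>i. sorted_list_of_set X ! (i - 1)) ` {1..card X})"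
    by (simp add: packet_def omit_def image_image)
  also have "(\<lambda>i. sorted_list_of_set X ! (i - 1)) ` {1..card X} =
      (!) (sorted_list_of_set X) ` {..<card X}"
  proof -
    have "{..<card X} = (\<lambda>i. i - 1) ` {1..card X}"
      by force
    then show ?thesis by (simp add: image_image)
  qed
  also have "\<dots> = X"
    using assms nth_image[of "card X" "sorted_list_of_set X"] by (simp add: lessThan_atLeast0)
  finally show ?thesis .
qed

lemma commute_sym: "commute X Y \<Longrightarrow> commute Y X"
  by (auto simp: commute_def)

text \<open>Removing both missing elements from \<open>Z\<close> gives a common member of the two
  packets.\<close>

lemma packet_not_commute:
  assumes "finite Z" "X \<in> packet Z" "Y \<in> packet Z" "X \<noteq> Y"
  shows "\<not> commute X Y"
proof -
  obtain x y where xy: "x \<in> Z" "y \<in> Z" "X = Z - {x}" "Y = Z - {y}"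
    using assms by (auto simp: packet_eq)
  with assms have "Z - {x, y} \<in> packet X" "Z - {x, y} \<in> packet Y"
    by (auto simp: packet_eq)
  then show ?thesis
    by (auto simp: commute_def)
qed

text \<open>A common member of the packets means that \<open>X\<close> and \<open>Y\<close> differ
  by exchanging one element, so their union has \<open>k + 1\<close> elements and serves as
  \<open>Z\<close>.\<close>

lemma not_commute_packet:
  assumes "X \<in> nsets A k" "Y \<in> nsets A k" "X \<noteq> Y" "\<not> commute X Y"
  obtains Z where "Z \<in> nsets A (k + 1)" "X \<in> packet Z" "Y \<in> packet Z"
proof -
  have fin: "finite X" "finite Y" and sub: "X \<subseteq> A" "Y \<subseteq> A"
    and card: "card X = k" "card Y = k"
    using assms by (auto simp: nsets_def)
  obtain x y where xy: "x \<in> X" "y \<in> Y" "X - {x} = Y - {y}"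
    using assms(4) fin by (auto simp: commute_def packet_eq)
  then have ne: "y \<notin> X" "x \<notin> Y"
    using assms(3) by blast+
  have "insert y X \<in> nsets A (k + 1)"
    using fin sub card ne xy by (auto simp: nsets_def)
  moreover have "X \<in> packet (insert y X)"
    using fin ne by (force simp: packet_eq)
  moreover have "Y = insert y X - {x}"
    using xy ne by blast
  then have "Y \<in> packet (insert y X)"
    using fin xy by (auto simp: packet_eq)
  ultimately show thesis
    by (rule that)
qed

lemma sorted_list_of_set_omit:
  assumes "finite X" "1 \<le> i" "i \<le> card X"
  shows "sorted_list_of_set (omit X i) =
    take (i - 1) (sorted_list_of_set X) @ drop i (sorted_list_of_set X)"
proof -
  define xs where "xs = sorted_list_of_set X"
  have len: "i - 1 < length xs"
    using assms by (simp add: xs_def)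
  then have split: "xs = take (i - 1) xs @ xs ! (i - 1) # drop i xs"
    using id_take_nth_drop assms(2) by fastforce
  have "distinct xs"
    by (simp add: xs_def)
  then have "xs ! (i - 1) \<notin> set (take (i - 1) xs)"
    using split by (metis distinct_append not_distinct_conv_prefix)
  then have "remove1 (xs ! (i - 1)) xs = take (i - 1) xs @ drop i xs"
    using split by (metis remove1.simps(2) remove1_append)
  then show ?thesis
    using assms by (simp add: omit_def sorted_list_of_set_remove xs_def)
qed

lemma card_omit:
  assumes "finite X" "1 \<le> i" "i \<le> card X"
  shows "card (omit X i) = card X - 1"
proof -
  have "sorted_list_of_set X ! (i - 1) \<in> set (sorted_list_of_set X)"
    using assms by (intro nth_mem) simp
  then show ?thesis
    using assms by (simp add: omit_def)
qed

lemma finite_omit [simp]: "finite X \<Longrightarrow> finite (omit X i)"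
  by (simp add: omit_def)

text \<open>The two lists agree on their first \<open>i - 1\<close> entries. The next entry is the
  \<open>i\<close>-th element of \<open>X\<close> when \<open>j\<close> is omitted, and the larger
  \<open>(i + 1)\<close>-th element when \<open>i\<close> is omitted.\<close>

lemma lex_less_omit:
  assumes "finite X" "1 \<le> i" "i < j" "j \<le> card X"
  shows "lex_less (omit X j) (omit X i)"
proof -
  define xs where "xs = sorted_list_of_set X"
  have len: "j \<le> length xs"
    using assms by (simp add: xs_def)
  have "take (j - 1) xs = take (i - 1) xs @ xs ! (i - 1) # drop i (take (j - 1) xs)"
    using id_take_nth_drop[of "i - 1" "take (j - 1) xs"] assms len by simp
  moreover have "drop i xs = xs ! i # drop (Suc i) xs"
    using assms len by (simp add: Cons_nth_drop_Suc)
  moreover have "xs ! (i - 1) < xs ! i"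
    using assms len strict_sorted_list_of_set[of X]
    by (auto simp: xs_def sorted_wrt_iff_nth_less)
  moreover have "sorted_list_of_set (omit X j) = take (j - 1) xs @ drop j xs"
    "sorted_list_of_set (omit X i) = take (i - 1) xs @ drop i xs"
    using assms by (simp_all add: sorted_list_of_set_omit xs_def)
  ultimately show ?thesis
    by (metis (mono_tags, lifting) append.assoc append_Cons case_prodI lex_less_def
        lexord_append_leftI lexord_cons_cons mem_Collect_eq)
qed

lemma inj_on_omit:
  assumes "finite X"
  shows "inj_on (omit X) {1..card X}"
proof (rule linorder_inj_onI')
  fix i j assume "i \<in> {1..card X}" "j \<in> {1..card X}" "i < j"
  then have "lex_less (omit X j) (omit X i)"
    using assms by (intro lex_less_omit) auto
  then show "omit X i \<noteq> omit X j"
    using asymp_lex_less by (auto dest: asympD)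
qed

text \<open>Both sides are \<open>Z\<close> without its minimum and maximum. The inner omission
  leaves \<open>k\<close> elements, so the maximum then has index \<open>k\<close>.\<close>

lemma omit_last_first:
  assumes "finite Z" "card Z = k + 1" "1 \<le> k"
  shows "omit (omit Z (k + 1)) 1 = omit (omit Z 1) k"
proof -
  have "sorted_list_of_set (omit (omit Z (k + 1)) 1) = sorted_list_of_set (omit (omit Z 1) k)"
    using assms by (simp add: sorted_list_of_set_omit card_omit drop_take)
  then show ?thesis
    using assms by (metis finite_omit set_sorted_list_of_set)
qed

section \<open>Admissible orders\<close>

text \<open>Omitting later elements gives lex smaller sets, so \<open>L\<close> is the antilex order
  of the packet and \<open>rev L\<close> the lex order; sorted lists with the same entries
  coincide.\<close>

lemma filter_packet_cases:
  assumes "\<rho> \<in> admissible_orders n k" "Z \<in> nsets {1..n} (k + 1)"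
  defines "L \<equiv> map (omit Z) [1..<k + 2]"
  shows "filter (\<lambda>Y. Y \<in> packet Z) \<rho> = L \<or> filter (\<lambda>Y. Y \<in> packet Z) \<rho> = rev L"
proof -
  let ?F = "filter (\<lambda>Y. Y \<in> packet Z) \<rho>"
  have Z: "finite Z" "card Z = k + 1" "Z \<subseteq> {1..n}"
    using assms(2) by (auto simp: nsets_def)
  have setL: "set L = packet Z"
    using Z by (auto simp: L_def packet_def simp del: upt_Suc)
  have "packet Z \<subseteq> nsets {1..n} k"
    using Z by (auto simp: packet_eq nsets_def)
  then have setF: "set ?F = packet Z"
    using assms(1) by (auto simp: admissible_orders_def)
  have L: "sorted_wrt antilex_less L"
    unfolding L_def sorted_wrt_map antilex_less_def
    using Z sorted_wrt_upt[of 1 "k + 2"]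
    by (elim sorted_wrt_mono_rel[rotated]) (auto intro: lex_less_omit)
  then have L': "sorted_wrt lex_less (rev L)"
    by (simp add: sorted_wrt_rev antilex_less_def[abs_def])
  have anti: "asymp antilex_less"
    using asymp_lex_less by (auto simp: antilex_less_def intro!: asympI dest: asympD)
  consider "sorted_wrt lex_less ?F" | "sorted_wrt antilex_less ?F"
    using assms(1,2) by (auto simp: admissible_orders_def)
  then show ?thesis
  proof cases
    case 1
    then show ?thesis
      using sorted_wrt_asymp_unique[OF asymp_lex_less _ L'] setL setF by auto
  next
    case 2
    then show ?thesis
      using sorted_wrt_asymp_unique[OF anti _ L] setL setF by auto
  qed
qed

section \<open>Commutation steps and classes of admissible orders\<close>

lemma commutation_stepI:
  "commute X Y \<Longrightarrow> (xs @ X # Y # ys, xs @ Y # X # ys) \<in> commutation_step"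
  unfolding commutation_step_def by blast

text \<open>Two distinct commuting sets never lie in one packet, so the swap leaves the restriction
  to each packet unchanged.\<close>

lemma commutation_step_admissible:
  assumes "(\<rho>, \<sigma>) \<in> commutation_step" "\<rho> \<in> admissible_orders n k"
  shows "\<sigma> \<in> admissible_orders n k"
proof -
  obtain xs X Y ys where *: "\<rho> = xs @ X # Y # ys" "\<sigma> = xs @ Y # X # ys" "commute X Y"
    using assms(1) by (auto simp: commutation_step_def)
  have "X \<noteq> Y"
    using assms(2) * by (auto simp: admissible_orders_def)
  have "filter (\<lambda>Y. Y \<in> packet Z) \<rho> = filter (\<lambda>Y. Y \<in> packet Z) \<sigma>"
    if "Z \<in> nsets {1..n} (k + 1)" for Z
    using packet_not_commute[of Z X Y] that * \<open>X \<noteq> Y\<close> by (auto simp: nsets_def)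
  moreover have "distinct \<sigma> = distinct \<rho>" "set \<sigma> = set \<rho>"
    using * by auto
  ultimately show ?thesis
    using assms(2) by (simp add: admissible_orders_def)
qed

lemma commutation_steps_admissible:
  assumes "(\<rho>, \<sigma>) \<in> commutation_step\<^sup>*" "\<rho> \<in> admissible_orders n k"
  shows "\<sigma> \<in> admissible_orders n k"
  using assms by (induction rule: rtrancl_induct) (auto intro: commutation_step_admissible)

lemma commutation_steps_move_front:
  assumes "\<And>X. X \<in> set a \<Longrightarrow> commute X Y"
  shows "(p @ a @ Y # b, p @ Y # a @ b) \<in> commutation_step\<^sup>*"
  using assms
\<comment> \<open>\<open>Y\<close> passes the last entry of \<open>a\<close> first; that entry then
  joins \<open>b\<close>.\<close>
proof (induction a arbitrary: b rule: rev_induct)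
  case Nil
  then show ?case by simp
next
  case (snoc X a)
  have "((p @ a) @ X # Y # b, (p @ a) @ Y # X # b) \<in> commutation_step"
    using snoc.prems by (intro commutation_stepI) simp
  moreover have "((p @ a) @ Y # X # b, p @ Y # a @ X # b) \<in> commutation_step\<^sup>*"
    using snoc.IH[of "X # b"] snoc.prems by simp
  ultimately have "((p @ a) @ X # Y # b, p @ Y # a @ X # b) \<in> commutation_step\<^sup>*"
    by (rule converse_rtrancl_into_rtrancl)
  then show ?case by simp
qed

lemma sym_commutation_steps: "sym (commutation_step\<^sup>*)"
proof (rule sym_rtrancl, rule symI)
  fix \<rho> \<sigma> assume "(\<rho>, \<sigma>) \<in> commutation_step"
  then show "(\<sigma>, \<rho>) \<in> commutation_step"
    by (auto simp: commutation_step_def dest: commute_sym)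
qed

lemma equiv_commutation_equiv: "equiv (admissible_orders n k) (commutation_equiv n k)"
proof (rule equivI)
  show "commutation_equiv n k \<subseteq> admissible_orders n k \<times> admissible_orders n k"
    by (auto simp: commutation_equiv_def)
  show "refl_on (admissible_orders n k) (commutation_equiv n k)"
    by (auto simp: commutation_equiv_def refl_on_def)
  show "sym (commutation_equiv n k)"
    using sym_commutation_steps by (auto simp: commutation_equiv_def intro!: symI dest: symD)
  show "trans (commutation_equiv n k)"
    by (auto simp: commutation_equiv_def intro!: transI dest: rtrancl_trans)
qed

text \<open>Members of a quotient are nonempty, whereas a list that is not admissible has an empty
  class.\<close>

lemma commutation_class_mem_higher_bruhat:
  assumes "commutation_class n k \<rho> \<in> higher_bruhat n k"
  shows "\<rho> \<in> admissible_orders n k"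
proof -
  have "commutation_class n k \<rho> \<noteq> {}"
    using assms in_quotient_imp_non_empty[OF equiv_commutation_equiv]
    by (auto simp: higher_bruhat_def)
  then show ?thesis
    by (auto simp: commutation_class_def commutation_equiv_def)
qed

section \<open>Weaving words\<close>

definition weaving_word :: "nat \<Rightarrow> nat set list \<Rightarrow> nat set \<Rightarrow> bit list" where
  "weaving_word k \<rho> X = concat (map (\<lambda>Y. letter k Y X) \<rho>)"

lemma weaving_word_simps [simp]:
  "weaving_word k [] X = []"
  "weaving_word k (Y # \<rho>) X = letter k Y X @ weaving_word k \<rho> X"
  "weaving_word k (\<rho> @ \<sigma>) X = weaving_word k \<rho> X @ weaving_word k \<sigma> X"
  by (simp_all add: weaving_word_def)

lemma weaving_eq_iff:
  "weaving n k \<rho> = weaving n k \<sigma> \<longleftrightarrow>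
    (\<forall>X \<in> nsets {1..n} (k - 1). weaving_word k \<rho> X = weaving_word k \<sigma> X)"
  by (auto simp: weaving_def weaving_word_def restrict_def fun_eq_iff)

lemma letter_eq_Nil:
  assumes "1 \<le> k" "card Y = k" "X \<notin> packet Y"
  shows "letter k Y X = []"
  using assms by (auto simp: letter_def packet_def)

text \<open>Letters of \<open>Y\<close> are nonempty only on the packet of \<open>Y\<close>.
  Disjoint packets therefore leave at most one nonempty letter at each set, and the swap does not
  change the word.\<close>

lemma commutation_step_weaving:
  assumes "1 \<le> k" "(\<rho>, \<sigma>) \<in> commutation_step" "\<rho> \<in> admissible_orders n k"
  shows "weaving n k \<rho> = weaving n k \<sigma>"
proof -
  obtain xs X Y ys where *: "\<rho> = xs @ X # Y # ys" "\<sigma> = xs @ Y # X # ys" "commute X Y"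
    using assms by (auto simp: commutation_step_def)
  then have "{X, Y} \<subseteq> nsets {1..n} k"
    using assms by (auto simp: admissible_orders_def)
  then have "card X = k" "card Y = k"
    by (auto simp: nsets_def)
  then have "letter k X V = [] \<or> letter k Y V = []" for V
    using assms(1) *(3) by (metis commute_def disjoint_iff letter_eq_Nil)
  then have "weaving_word k \<rho> V = weaving_word k \<sigma> V" for V
    unfolding *(1,2) by (metis append_Nil weaving_word_simps(2,3))
  then show ?thesis
    by (simp add: weaving_eq_iff)
qed

lemma commutation_steps_weaving:
  assumes "(\<rho>, \<sigma>) \<in> commutation_step\<^sup>*" "1 \<le> k" "\<rho> \<in> admissible_orders n k"
  shows "weaving n k \<rho> = weaving n k \<sigma>"
  using assms
proof (induction rule: rtrancl_induct)
  case base
  then show ?case by simp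
next
  case (step \<tau> \<sigma>)
  then show ?case
    using commutation_steps_admissible commutation_step_weaving by metis
qed

section \<open>From equal weaving functions to commutations\<close>

lemma weaving_eq_imp_commute:
  assumes k: "2 \<le> k"
    and adm: "p @ a @ Y # b \<in> admissible_orders n k" "p @ Y # s \<in> admissible_orders n k"
    and weav: "weaving n k (p @ a @ Y # b) = weaving n k (p @ Y # s)"
    and U: "U \<in> set a"
  shows "commute U Y"
proof (rule ccontr)
  assume "\<not> commute U Y"
  then obtain a1 U a2 where a: "a = a1 @ U # a2" and U: "\<not> commute U Y"
    and a1: "\<And>X. X \<in> set a1 \<Longrightarrow> commute X Y"
    using split_list_first_prop[of a "\<lambda>X. \<not> commute X Y"] \<open>U \<in> set a\<close> by blast
  have nsets: "set (p @ a @ Y # b) = nsets {1..n} k" and dist: "distinct (p @ a @ Y # b)"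
    using adm(1) by (auto simp: admissible_orders_def)
  have "U \<in> nsets {1..n} k" and Y: "Y \<in> nsets {1..n} k" and a1_nsets: "set a1 \<subseteq> nsets {1..n} k"
    using nsets by (auto simp: a)
  then obtain Z where Z: "Z \<in> nsets {1..n} (k + 1)" "U \<in> packet Z" "Y \<in> packet Z"
    using not_commute_packet[of U "{1..n}" k Y] U dist by (auto simp: a)
  then have fin: "finite Z" and card: "card Z = k + 1"
    by (auto simp: nsets_def)

  define F where "F = filter (\<lambda>Y. Y \<in> packet Z)"
  define L where "L = map (omit Z) [1..<k + 2]"
  have L_ends: "hd L = omit Z 1" "last L = omit Z (k + 1)"
    by (simp_all add: L_def hd_map del: upt_Suc) simp
  have L: "distinct L" "L \<noteq> []" "hd L \<noteq> last L"
  proof -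
    show "distinct L"
      using inj_on_omit[OF fin] card
      by (auto simp: L_def distinct_map inj_on_def simp del: upt_Suc)
    show "L \<noteq> []"
      by (simp add: L_def)
    show "hd L \<noteq> last L"
      using inj_on_eq_iff[OF inj_on_omit[OF fin], of 1 "k + 1"] card k by (simp add: L_ends)
  qed
  \<comment> \<open>Entries of \<open>a1\<close> commute with \<open>Y\<close>, but distinct members
    of the packet of \<open>Z\<close> do not commute.\<close>
  have "F a1 = []"
    using a1 dist fin Z(3) packet_not_commute[of Z _ Y]
    by (fastforce simp: F_def a filter_empty_conv)
  then have F\<rho>: "F (p @ a @ Y # b) = F p @ U # F a2 @ Y # F b"
    and F\<sigma>: "F (p @ Y # s) = F p @ Y # F s"
    using Z by (simp_all add: F_def a)
  have "U \<noteq> Y"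
    using dist by (auto simp: a)
  have cases: "F (p @ a @ Y # b) = L \<or> F (p @ a @ Y # b) = rev L"
    "F (p @ Y # s) = L \<or> F (p @ Y # s) = rev L"
    using filter_packet_cases[OF adm(1) Z(1)] filter_packet_cases[OF adm(2) Z(1)]
    by (simp_all only: F_def L_def)
  \<comment> \<open>A packet member in \<open>p\<close> would give both restrictions the same head.
    As \<open>L\<close> and \<open>rev L\<close> have different heads, the restrictions would
    coincide, although one continues with \<open>U\<close> and the other with
    \<open>Y\<close>.\<close>
  have "F p = []"
  proof (rule ccontr)
    assume "F p \<noteq> []"
    then have "hd (F (p @ a @ Y # b)) = hd (F (p @ Y # s))"
      by (simp add: F\<rho> F\<sigma>)
    then have "F (p @ a @ Y # b) = F (p @ Y # s)"
      using cases L by (metis hd_rev)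
    then show False
      using \<open>U \<noteq> Y\<close> by (simp add: F\<rho> F\<sigma>)
  qed
  then have hds: "hd (F (p @ a @ Y # b)) = U" "hd (F (p @ Y # s)) = Y"
    by (simp_all add: F\<rho> F\<sigma>)
  then have ends: "(U = omit Z 1 \<and> Y = omit Z (k + 1)) \<or> (U = omit Z (k + 1) \<and> Y = omit Z 1)"
    using cases \<open>U \<noteq> Y\<close> by (metis hd_rev L_ends)

  have cardUY: "card U = k" "card Y = k" "finite U" "finite Y"
    using \<open>U \<in> nsets {1..n} k\<close> Y by (auto simp: nsets_def)
  \<comment> \<open>Here \<open>k \<ge> 2\<close> matters: it keeps the two nonempty clauses of
    \<open>letter\<close> from overlapping.\<close>
  have neq: "omit V 1 \<noteq> omit V k" if "card V = k" "finite V" for V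
    using inj_on_eq_iff[OF inj_on_omit[OF that(2)], of 1 k] that k by simp
  \<comment> \<open>This is \<open>Z\<close> without both extremes. It is the first omission of one
    of \<open>U\<close>, \<open>Y\<close> and the last of the other, so their letters at
    \<open>V\<close> differ.\<close>
  define V where "V = omit (omit Z 1) k"
  have V: "V = omit (omit Z (k + 1)) 1"
    using omit_last_first[OF fin card] k by (simp add: V_def)
  have V_ends: "(V = omit U k \<and> V = omit Y 1 \<and> V \<noteq> omit Y k) \<or>
      (V = omit Y k \<and> V = omit U 1 \<and> V \<noteq> omit U k)"
    using ends V V_def neq cardUY by metis
  then have "(letter k U V = [0] \<and> letter k Y V = [1]) \<or> (letter k U V = [1] \<and> letter k Y V = [0])"
    unfolding letter_def by metis
  then have letters: "letter k U V \<noteq> []" "letter k Y V \<noteq> []"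
    "hd (letter k U V) \<noteq> hd (letter k Y V)"
    by fastforce+
  have "omit Y 1 \<in> packet Y" "omit Y k \<in> packet Y"
    using cardUY k by (simp_all add: packet_def)
  then have "V \<in> packet Y"
    using V_ends by metis
  then have "V \<in> nsets {1..n} (k - 1)"
    using Y cardUY by (auto simp: packet_eq nsets_def)
  then have "weaving_word k (a @ Y # b) V = weaving_word k (Y # s) V"
    using weav by (simp add: weaving_eq_iff)
  moreover have "weaving_word k a1 V = []"
  proof -
    have "letter k T V = []" if "T \<in> set a1" for T
      using that a1 a1_nsets \<open>V \<in> packet Y\<close> k
      by (intro letter_eq_Nil) (auto simp: commute_def nsets_def)
    then show ?thesis
      by (simp add: weaving_word_def)
  qed
  \<comment> \<open>The prefix \<open>p\<close> has been cancelled and \<open>a1\<close> contributes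
    nothing, so the equal words begin with the letters of \<open>U\<close> and \<open>Y\<close>
    respectively.\<close>
  ultimately show False
    using letters by (simp add: a) (metis hd_append2)
qed

text \<open>Induction on \<open>s\<close> with a growing common prefix: each round moves the next
  entry \<open>Y\<close> of the target to the front of \<open>r\<close>, which preserves
  admissibility and the weaving function, and appends it to \<open>p\<close>.\<close>

lemma weaving_eq_imp_commutation_steps:
  assumes "2 \<le> k" "p @ r \<in> admissible_orders n k" "p @ s \<in> admissible_orders n k"
    and "weaving n k (p @ r) = weaving n k (p @ s)"
  shows "(p @ r, p @ s) \<in> commutation_step\<^sup>*"
  using assms(2-4)
proof (induction s arbitrary: p r)
  case Nil
  then have "set p = set (p @ r)" "distinct (p @ r)"
    unfolding admissible_orders_def by simp_all
  then have "r = []"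
    by (cases r) auto
  then show ?case by simp
next
  case (Cons Y s)
  have "Y \<in> set r"
    using Cons.prems(1,2) by (auto simp: admissible_orders_def)
  then obtain a b where r: "r = a @ Y # b"
    by (meson split_list)
  have "commute X Y" if "X \<in> set a" for X
    using weaving_eq_imp_commute[OF assms(1)] Cons.prems that r by metis
  then have steps: "(p @ r, p @ Y # a @ b) \<in> commutation_step\<^sup>*"
    unfolding r by (rule commutation_steps_move_front)
  have "p @ Y # a @ b \<in> admissible_orders n k"
    using commutation_steps_admissible[OF steps] Cons.prems by blast
  moreover have "weaving n k (p @ Y # a @ b) = weaving n k (p @ Y # s)"
    using commutation_steps_weaving[OF steps] Cons.prems assms(1) by simp
  ultimately have "((p @ [Y]) @ a @ b, (p @ [Y]) @ s) \<in> commutation_step\<^sup>*"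
    using Cons.prems by (intro Cons.IH) auto
  then show ?case
    using steps by simp
qed

section \<open>The case \<open>k = 1\<close> and the equivalence\<close>

lemma admissible_orders_one_one:
  assumes "\<rho> \<in> admissible_orders 1 1"
  shows "\<rho> = [{1}]"
proof -
  have "nsets {1..1} 1 = {{1::nat}}"
    unfolding atLeastAtMost_singleton nsets_singleton_iff by simp
  then have \<rho>: "distinct \<rho>" "set \<rho> = {{1}}"
    using assms unfolding admissible_orders_def by auto
  then have "length \<rho> = 1"
    using distinct_card[of \<rho>] by simp
  then obtain x where "\<rho> = [x]"
    by (cases \<rho>) auto
  with \<rho>(2) show ?thesis
    by simp
qed

text \<open>The third assumption excludes \<open>k = 1 < n\<close>, where
  \<open>weaving_not_injective_for_singletons\<close> gives counterexamples. The remaining case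
  \<open>k = n = 1\<close> has a single admissible order.\<close>

theorem theorem43:
  fixes n k :: nat and \<rho> \<sigma> :: "nat set list"
  assumes "1 \<le> k" and "k \<le> n"
    and "k = 1 \<longrightarrow> n = 1"
    and "commutation_class n k \<rho> \<in> higher_bruhat n k"
    and "commutation_class n k \<sigma> \<in> higher_bruhat n k"
  shows "commutation_class n k \<rho> = commutation_class n k \<sigma> \<longleftrightarrow> weaving n k \<rho> = weaving n k \<sigma>"
proof -
  have adm: "\<rho> \<in> admissible_orders n k" "\<sigma> \<in> admissible_orders n k"
    using assms(4,5) by (auto intro: commutation_class_mem_higher_bruhat)
  have "commutation_class n k \<rho> = commutation_class n k \<sigma> \<longleftrightarrow> (\<rho>, \<sigma>) \<in> commutation_step\<^sup>*"
    using eq_equiv_class_iff[OF equiv_commutation_equiv] adm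
    by (simp add: commutation_class_def) (simp add: commutation_equiv_def)
  also have "\<dots> \<longleftrightarrow> weaving n k \<rho> = weaving n k \<sigma>"
  proof
    assume "(\<rho>, \<sigma>) \<in> commutation_step\<^sup>*"
    then show "weaving n k \<rho> = weaving n k \<sigma>"
      using adm assms(1) by (intro commutation_steps_weaving)
  next
    assume weav: "weaving n k \<rho> = weaving n k \<sigma>"
    show "(\<rho>, \<sigma>) \<in> commutation_step\<^sup>*"
    proof (cases "k = 1")
      case True
      then show ?thesis
        using admissible_orders_one_one adm assms(3) by blast
    next
      case False
      then show ?thesis
        using weaving_eq_imp_commutation_steps[of k "[]"] adm assms(1) weav by simp
    qed
  qed
  finally show ?thesis .
qed

end
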